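(* Let $\Omega\subset\mathbb{R}^n$, $n\ge 2$, be a bounded domain, and let $f:\Omega\times\mathbb{R}\to\mathbb{R}$ and $g:\Omega\times\mathbb{R}\to\mathbb{R}$ be continuous. Suppose that $u\in C(\overline{\Omega})$ and $v\in C(\overline{\Omega})$. (a) If $\sup_{\Omega}(u-v)>\sup_{\partial\Omega}(u-v)$ and, in the sense of viscosity, $$\Delta_\infty u+f(x,u(x))\ge 0\quad\text{and}\quad \Delta_\infty v+g(x,v(x))\le 0,\quad\forall\,x\in\Omega,$$ then there is a point $p\in\Omega$ such that $(u-v)(p)=\sup_{\Omega}(u-v)$ and $g(p,v(p))\le f(p,u(p))$. (b) Analogously, if $\inf_{\Omega}(u-v)<\inf_{\partial\Omega}(u-v)$ and, in the sense of viscosity, $$\Delta_\infty u+f(x,u(x))\le 0\quad\text{and}\quad \Delta_\infty v+g(x,v(x))\ge 0,\quad\forall\,x\in\Omega,$$ then there is a point $q\in\Omega$ such that $(u-v)(q)=\inf_{\Omega}(u-v)$ and $f(q,u(q))\le g(q,v(q))$.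
   Context: The infinity-Laplacian is $\Delta_\infty u=\sum_{i,j=1}^n \frac{\partial u}{\partial x_i}\frac{\partial u}{\partial x_j}\frac{\partial^2 u}{\partial x_i\partial x_j}$. Differential inequalities are understood in the viscosity sense: for $F\in C(\Omega\times\mathbb{R})$, a function $u\in C(\Omega)$ satisfies $\Delta_\infty u\ge F(x,u)$ in $\Omega$ if, whenever $\psi\in C^2(\Omega)$ and $u-\psi$ has a local maximum at $p\in\Omega$, one has $\Delta_\infty\psi(p)\ge F(p,u(p))$; it satisfies $\Delta_\infty u\le F(x,u)$ in $\Omega$ if, whenever $\psi\in C^2(\Omega)$ and $u-\psi$ has a local minimum at $q\in\Omega$, one has $\Delta_\infty\psi(q)\le F(q,u(q))$. The inequality $\Delta_\infty u+f(x,u)\ge 0$ means $\Delta_\infty u\ge -f(x,u)$, and similarly for $\le$. *)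

theory Defs
  imports "HOL-Analysis.Analysis"
begin

definition partial_deriv :: "'n::finite \<Rightarrow> (real^'n \<Rightarrow> real) \<Rightarrow> real^'n \<Rightarrow> real" where
  "partial_deriv i \<psi> x = deriv (\<lambda>t. \<psi> (x + t *\<^sub>R axis i 1)) 0"

text \<open>For open \<open>\<Omega>\<close>; \<open>C1_on\<close> and \<open>C2_on\<close> depend on the values of the function
  in \<open>\<Omega>\<close> only.\<close>

definition C1_on :: "(real^'n::finite) set \<Rightarrow> (real^'n \<Rightarrow> real) \<Rightarrow> bool" where
  "C1_on \<Omega> \<psi> \<longleftrightarrow> continuous_on \<Omega> \<psi> \<and>
     (\<forall>i. (\<forall>x\<in>\<Omega>. (\<lambda>t. \<psi> (x + t *\<^sub>R axis i 1)) differentiable (at (0::real))) \<and>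
          continuous_on \<Omega> (partial_deriv i \<psi>))"

definition C2_on :: "(real^'n::finite) set \<Rightarrow> (real^'n \<Rightarrow> real) \<Rightarrow> bool" where
  "C2_on \<Omega> \<psi> \<longleftrightarrow> C1_on \<Omega> \<psi> \<and> (\<forall>i. C1_on \<Omega> (partial_deriv i \<psi>))"

definition inf_laplacian :: "(real^'n::finite \<Rightarrow> real) \<Rightarrow> real^'n \<Rightarrow> real" where
  "inf_laplacian \<psi> x =
     (\<Sum>i\<in>UNIV. \<Sum>j\<in>UNIV. partial_deriv i \<psi> x * partial_deriv j \<psi> x *
        partial_deriv i (partial_deriv j \<psi>) x)"

definition viscosity_ge ::
  "(real^'n::finite) set \<Rightarrow> (real^'n \<Rightarrow> real \<Rightarrow> real) \<Rightarrow> (real^'n \<Rightarrow> real) \<Rightarrow> bool" where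
  "viscosity_ge \<Omega> F u \<longleftrightarrow> continuous_on \<Omega> u \<and>
     (\<forall>\<psi>. \<forall>p\<in>\<Omega>. C2_on \<Omega> \<psi> \<longrightarrow>
        (\<forall>\<^sub>F x in at p within \<Omega>. u x - \<psi> x \<le> u p - \<psi> p) \<longrightarrow>
        inf_laplacian \<psi> p \<ge> F p (u p))"

definition viscosity_le ::
  "(real^'n::finite) set \<Rightarrow> (real^'n \<Rightarrow> real \<Rightarrow> real) \<Rightarrow> (real^'n \<Rightarrow> real) \<Rightarrow> bool" where
  "viscosity_le \<Omega> F u \<longleftrightarrow> continuous_on \<Omega> u \<and>
     (\<forall>\<psi>. \<forall>q\<in>\<Omega>. C2_on \<Omega> \<psi> \<longrightarrow>
        (\<forall>\<^sub>F x in at q within \<Omega>. u x - \<psi> x \<ge> u q - \<psi> q) \<longrightarrow>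
        inf_laplacian \<psi> q \<le> F q (u q))"

end

theory Submission
  imports Defs
begin

text \<open>Write \<open>w = - v\<close>, so that part (a) asks about interior maxima of
  \<open>u + w\<close>. Take \<open>x0\<close> to be a limit, as \<open>e \<rightarrow> 0\<close>, of pairs \<open>(y, z)\<close> that maximise \<open>u y + w z\<close> subject
  to \<open>\<bar>y - z\<bar> \<le> 2 e\<close>. It maximises \<open>u - v\<close> over the closure of \<open>\<Omega>\<close>, and it lies in \<open>\<Omega>\<close> because of the
  strict inequality between the suprema. If the claim failed at \<open>x0\<close>, there would be constants
  \<open>k2 < k < k1\<close> with \<open>k \<noteq> 0\<close> such that near \<open>x0\<close> the function \<open>u\<close> satisfies \<open>\<Delta>\<^sub>\<infinity> u \<ge> k1\<close> and \<open>w\<close> satisfies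
  \<open>\<Delta>\<^sub>\<infinity> w \<ge> - k2\<close>, both in the sense of viscosity. Exchanging \<open>u\<close> and \<open>w\<close> if necessary, assume \<open>k > 0\<close>.

  The contradiction comes from radial functions, on which the infinity-Laplacian acts as the ordinary
  differential operator \<open>\<phi>'\<^sup>2 \<phi>''\<close>. The solutions of \<open>\<phi>'\<^sup>2 \<phi>'' = k\<close> are given by \<open>\<phi>'\<^sup>3 = C + 3 k r\<close>. Let
  \<open>x\<close> be the midpoint of a maximising pair \<open>(y, z)\<close>. Both points lie in the closed ball of radius \<open>e\<close>
  about \<open>x\<close>, and any two points of that ball have distance at most \<open>2 e\<close>; so \<open>y\<close> maximises \<open>u\<close> there,
  and \<open>z\<close> maximises \<open>w\<close>. Choose \<open>C \<ge> 0\<close> and the additive constant such that \<open>\<phi> 0 = u x\<close> and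
  \<open>\<phi> e = u y\<close>; that \<open>C\<close> exists is a minimal growth property of \<open>u\<close>, lemma \<open>subsolution_growth\<close>.
  By lemma \<open>radial_comparison\<close>, \<open>u\<close> cannot stay below \<open>\<phi>(2 e)\<close> on the sphere of radius \<open>2 e\<close>, for
  then \<open>u y < \<phi> e\<close> would follow. So some \<open>q\<close> on this sphere has \<open>u q > \<phi>(2 e)\<close>. Let
  \<open>T = u y + w z\<close>. The maximality of \<open>(y, z)\<close>, applied to \<open>(q, x)\<close> and to the pairs \<open>(x, p)\<close> with
  \<open>\<bar>p - x\<bar> = 2 e\<close>, gives \<open>w x < T - \<phi>(2 e)\<close> and \<open>w p \<le> T - \<phi> 0\<close>. These are the boundary values at
  the centre and on the sphere of the reversed profile \<open>r \<mapsto> T - \<phi>(2 e - r)\<close>, which solves the equation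
  with right-hand side \<open>- k\<close>. Comparing \<open>w\<close> with this profile yields \<open>w z < T - \<phi> e = w z\<close>.

  Part (b) is part (a) with the roles of \<open>(u, f)\<close> and \<open>(v, g)\<close> exchanged.\<close>

section \<open>Radial quartic test functions\<close>

text \<open>A function of \<open>y\<close> that is quadratic in \<open>\<bar>y - z\<bar>\<^sup>2\<close>. Such polynomials are smooth everywhere, also at
  the centre \<open>z\<close>, and have prescribed first and second radial derivatives at a given distance
  from \<open>z\<close>; they replace radial functions that are smooth only away from their centre.\<close>

definition radial_quartic :: "real^'n::finite \<Rightarrow> real \<Rightarrow> real \<Rightarrow> real \<Rightarrow> real^'n \<Rightarrow> real" where
  "radial_quartic z s c d y = c * ((norm (y - z))\<^sup>2 - s) + d * ((norm (y - z))\<^sup>2 - s)\<^sup>2"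

lemma norm_axis_shift:
  fixes y z :: "real^'n::finite"
  shows "(norm (y + t *\<^sub>R axis i 1 - z))\<^sup>2 = (norm (y - z))\<^sup>2 + 2 * t * (y - z) $ i + t\<^sup>2"
proof -
  have *: "y + t *\<^sub>R axis i 1 - z = (y - z) + t *\<^sub>R axis i 1" by simp
  show ?thesis
    unfolding * power2_norm_eq_inner
    by (simp add: inner_add_left inner_add_right inner_axis inner_axis' power2_eq_square algebra_simps)
qed

lemma radial_quartic_axis_deriv:
  fixes y z :: "real^'n::finite"
  shows "((\<lambda>t. radial_quartic z s c d (y + t *\<^sub>R axis i 1)) has_field_derivative
     2 * (c + 2 * d * ((norm (y - z))\<^sup>2 - s)) * (y - z) $ i) (at 0)"
  unfolding radial_quartic_def norm_axis_shift
  by (auto intro!: derivative_eq_intros simp: algebra_simps)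

lemma partial_deriv_radial_quartic:
  fixes z :: "real^'n::finite"
  shows "partial_deriv i (radial_quartic z s c d) =
    (\<lambda>y. 2 * (c + 2 * d * ((norm (y - z))\<^sup>2 - s)) * (y - z) $ i)"
  unfolding partial_deriv_def using radial_quartic_axis_deriv by (intro ext DERIV_imp_deriv)

lemma radial_quartic_axis_deriv2:
  fixes y z :: "real^'n::finite"
  shows "((\<lambda>t. partial_deriv j (radial_quartic z s c d) (y + t *\<^sub>R axis i 1)) has_field_derivative
     8 * d * (y - z) $ i * (y - z) $ j +
     2 * (c + 2 * d * ((norm (y - z))\<^sup>2 - s)) * (if i = j then 1 else 0)) (at 0)"
  unfolding partial_deriv_radial_quartic norm_axis_shift
  by (auto intro!: derivative_eq_intros simp: axis_def algebra_simps)

lemma partial_deriv2_radial_quartic: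
  fixes z :: "real^'n::finite"
  shows "partial_deriv i (partial_deriv j (radial_quartic z s c d)) =
    (\<lambda>y. 8 * d * (y - z) $ i * (y - z) $ j +
     2 * (c + 2 * d * ((norm (y - z))\<^sup>2 - s)) * (if i = j then 1 else 0))"
  unfolding partial_deriv_def[of i "partial_deriv j (radial_quartic z s c d)"]
  using radial_quartic_axis_deriv2 by (intro ext DERIV_imp_deriv)

lemma C2_on_radial_quartic: "C2_on \<Omega> (radial_quartic z s c d)"
proof -
  have "continuous_on \<Omega> (radial_quartic z s c d)"
    unfolding radial_quartic_def by (intro continuous_intros)
  moreover have "continuous_on \<Omega> (partial_deriv i (radial_quartic z s c d))" for i
    unfolding partial_deriv_radial_quartic by (intro continuous_intros)
  moreover have "continuous_on \<Omega> (partial_deriv i (partial_deriv j (radial_quartic z s c d)))" for i j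
    unfolding partial_deriv2_radial_quartic by (intro continuous_intros)
  ultimately show ?thesis
    using radial_quartic_axis_deriv radial_quartic_axis_deriv2
    unfolding C2_on_def C1_on_def real_differentiable_def by blast
qed

lemma inf_laplacian_radial_quartic:
  fixes p z :: "real^'n::finite"
  shows "inf_laplacian (radial_quartic z ((norm (p - z))\<^sup>2) c d) p =
    8 * c^3 * (norm (p - z))^2 + 32 * c\<^sup>2 * d * (norm (p - z))^4"
proof -
  define q where "q = p - z"
  have n: "(norm q)\<^sup>2 = (\<Sum>i\<in>UNIV. q $ i * q $ i)"
    by (simp add: power2_norm_eq_inner inner_vec_def)
  have "inf_laplacian (radial_quartic z ((norm (p - z))\<^sup>2) c d) p
      = (\<Sum>i\<in>UNIV. \<Sum>j\<in>UNIV. 32 * c\<^sup>2 * d * ((q $ i * q $ i) * (q $ j * q $ j)) +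
           (if i = j then 8 * c^3 * (q $ i * q $ i) else 0))"
    unfolding inf_laplacian_def partial_deriv2_radial_quartic
    unfolding partial_deriv_radial_quartic q_def
    by (intro sum.cong refl) (simp add: algebra_simps power2_eq_square power3_eq_cube)
  also have "\<dots> = 32 * c\<^sup>2 * d * ((norm q)\<^sup>2 * (norm q)\<^sup>2) + 8 * c^3 * (norm q)\<^sup>2"
    unfolding n sum_product by (simp add: sum.distrib sum_distrib_left)
  also have "(norm q)\<^sup>2 * (norm q)\<^sup>2 = norm q ^ 4"
    by (simp flip: power_add)
  finally show ?thesis
    by (simp add: q_def)
qed

section \<open>Subsolutions with respect to radial test functions\<close>

text \<open>The inequality \<open>\<Delta>\<^sub>\<infinity> w \<ge> k\<close> tested only against radial quartics; the right-hand side of the last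
  inequality is the infinity-Laplacian of the test function at \<open>p\<close>, see
  \<open>inf_laplacian_radial_quartic\<close>. The class of radial quartics is closed under negation, so
  viscosity subsolutions \<open>u\<close> and negated supersolutions \<open>- v\<close> are both covered.\<close>

definition radial_subsolution :: "(real^'n::finite) set \<Rightarrow> real \<Rightarrow> (real^'n \<Rightarrow> real) \<Rightarrow> bool" where
  "radial_subsolution S k w \<longleftrightarrow> continuous_on S w \<and>
     (\<forall>p\<in>S. \<forall>z c d.
        (\<forall>\<^sub>F y in at p. w y \<le> w p + radial_quartic z ((norm (p - z))\<^sup>2) c d y) \<longrightarrow>
        k \<le> 8 * c^3 * (norm (p - z))^2 + 32 * c\<^sup>2 * d * (norm (p - z))^4)"

lemma radial_quartic_base: "radial_quartic z ((norm (p - z))\<^sup>2) c d p = 0"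
  by (simp add: radial_quartic_def)

lemma viscosity_ge_imp_radial_subsolution:
  fixes u :: "real^'n::finite \<Rightarrow> real"
  assumes "viscosity_ge \<Omega> F u" "S \<subseteq> \<Omega>" "\<And>p. p \<in> S \<Longrightarrow> k \<le> F p (u p)"
  shows "radial_subsolution S k u"
  unfolding radial_subsolution_def
proof (intro conjI ballI allI impI)
  show "continuous_on S u"
    using assms by (auto simp: viscosity_ge_def intro: continuous_on_subset)
  fix p z :: "real^'n" and c d :: real
  let ?\<psi> = "radial_quartic z ((norm (p - z))\<^sup>2) c d"
  assume p: "p \<in> S" and "\<forall>\<^sub>F y in at p. u y \<le> u p + ?\<psi> y"
  then have "\<forall>\<^sub>F y in at p within \<Omega>. u y - ?\<psi> y \<le> u p - ?\<psi> p"
    by (auto simp: radial_quartic_base algebra_simps eventually_at_filter elim!: eventually_mono)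
  then have "F p (u p) \<le> inf_laplacian ?\<psi> p"
    using assms p C2_on_radial_quartic unfolding viscosity_ge_def by blast
  then show "k \<le> 8 * c^3 * (norm (p - z))^2 + 32 * c\<^sup>2 * d * (norm (p - z))^4"
    using assms(3)[OF p] by (simp add: inf_laplacian_radial_quartic)
qed

lemma viscosity_le_imp_radial_subsolution:
  fixes v :: "real^'n::finite \<Rightarrow> real"
  assumes "viscosity_le \<Omega> F v" "S \<subseteq> \<Omega>" "\<And>p. p \<in> S \<Longrightarrow> F p (v p) \<le> k"
  shows "radial_subsolution S (- k) (\<lambda>x. - v x)"
  unfolding radial_subsolution_def
proof (intro conjI ballI allI impI)
  show "continuous_on S (\<lambda>x. - v x)"
    using assms by (auto simp: viscosity_le_def intro!: continuous_intros intro: continuous_on_subset)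
  fix p z :: "real^'n" and c d :: real
  let ?\<psi> = "radial_quartic z ((norm (p - z))\<^sup>2) (- c) (- d)"
  assume p: "p \<in> S" and "\<forall>\<^sub>F y in at p. - v y \<le> - v p + radial_quartic z ((norm (p - z))\<^sup>2) c d y"
  then have "\<forall>\<^sub>F y in at p within \<Omega>. v y - ?\<psi> y \<ge> v p - ?\<psi> p"
    by (auto simp: radial_quartic_def algebra_simps eventually_at_filter elim!: eventually_mono)
  then have "inf_laplacian ?\<psi> p \<le> F p (v p)"
    using assms p C2_on_radial_quartic unfolding viscosity_le_def by blast
  then show "- k \<le> 8 * c^3 * (norm (p - z))^2 + 32 * c\<^sup>2 * d * (norm (p - z))^4"
    using assms(3)[OF p] by (simp add: inf_laplacian_radial_quartic)
qed

text \<open>The second derivative is needed at one point only: there the derivative of the difference of the two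
  sides has the positive slope \<open>\<eta>\<close>, so this difference decreases before \<open>s0\<close> and increases after it.\<close>

lemma second_order_upper_bound:
  fixes F F1 :: "real \<Rightarrow> real"
  assumes F: "\<forall>\<^sub>F s in nhds s0. (F has_real_derivative F1 s) (at s)"
    and F1: "(F1 has_real_derivative F2) (at s0)" and "0 < \<eta>"
  shows "\<forall>\<^sub>F s in nhds s0. F s \<le> F s0 + F1 s0 * (s - s0) + (F2 + \<eta>) / 2 * (s - s0)\<^sup>2"
proof -
  define D where "D = (\<lambda>s. F s0 + F1 s0 * (s - s0) + (F2 + \<eta>) / 2 * (s - s0)\<^sup>2 - F s)"
  define E where "E = (\<lambda>s. F1 s0 + (F2 + \<eta>) * (s - s0) - F1 s)"
  have E0: "E s0 = 0" by (simp add: E_def)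
  have dE: "(E has_real_derivative \<eta>) (at s0)"
    unfolding E_def by (rule derivative_eq_intros F1 | simp)+
  obtain e1 where e1: "e1 > 0" "\<And>h. 0 < h \<Longrightarrow> h < e1 \<Longrightarrow> E s0 < E (s0 + h)"
    using DERIV_pos_inc_right[OF dE \<open>0 < \<eta>\<close>] by auto
  obtain e2 where e2: "e2 > 0" "\<And>h. 0 < h \<Longrightarrow> h < e2 \<Longrightarrow> E (s0 - h) < E s0"
    using DERIV_pos_inc_left[OF dE \<open>0 < \<eta>\<close>] by auto
  obtain e3 where e3: "e3 > 0" "\<And>s. dist s s0 < e3 \<Longrightarrow> (F has_real_derivative F1 s) (at s)"
    using F unfolding eventually_nhds_metric by auto
  define e where "e = min e1 (min e2 e3)"
  have dD: "(D has_real_derivative E s) (at s)" if "dist s s0 < e" for s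
    unfolding D_def E_def using e3(2)[of s] that
    by (auto intro!: derivative_eq_intros simp: e_def field_simps)
  have "D s0 \<le> D s" if s: "dist s s0 < e" for s
  proof (cases s s0 rule: linorder_cases)
    case less
    show ?thesis
    proof (rule DERIV_nonpos_imp_nonincreasing[of s s0 D])
      show "\<exists>y. (D has_real_derivative y) (at x) \<and> y \<le> 0" if "s \<le> x" "x \<le> s0" for x
      proof (intro exI conjI)
        show "(D has_real_derivative E x) (at x)"
          using that s by (intro dD) (auto simp: dist_real_def)
        show "E x \<le> 0"
          using e2(2)[of "s0 - x"] that s E0 by (cases "x = s0") (auto simp: dist_real_def e_def)
      qed
    qed (use less in auto)
  next
    case greater
    show ?thesis
    proof (rule DERIV_nonneg_imp_nondecreasing[of s0 s D])
      show "\<exists>y. (D has_real_derivative y) (at x) \<and> 0 \<le> y" if "s0 \<le> x" "x \<le> s" for x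
      proof (intro exI conjI)
        show "(D has_real_derivative E x) (at x)"
          using that s by (intro dD) (auto simp: dist_real_def)
        show "0 \<le> E x"
          using e1(2)[of "x - s0"] that s E0 by (cases "x = s0") (auto simp: dist_real_def e_def)
      qed
    qed (use greater in auto)
  qed auto
  then show ?thesis
    unfolding eventually_nhds_metric using e1(1) e2(1) e3(1)
    by (intro exI[of _ e]) (auto simp: D_def e_def)
qed

text \<open>Radial functions \<open>\<phi>(\<bar>y - x\<bar>)\<close> are admissible test functions away from \<open>x\<close>: in the variable
  \<open>s = \<bar>y - x\<bar>\<^sup>2\<close> they lie, near the touching point, below their second-order Taylor polynomial with second
  derivative raised by \<open>\<eta>\<close>, which is a radial quartic touching at the same point.\<close>

lemma radial_subsolution_touch:
  fixes u :: "real^'n::finite \<Rightarrow> real"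
  assumes u: "radial_subsolution S k u" and p: "p \<in> S" "p \<noteq> x"
    and touch: "\<forall>\<^sub>F y in at p. u y - \<phi> (norm (y - x)) \<le> u p - \<phi> (norm (p - x))"
    and \<phi>: "\<forall>\<^sub>F r in nhds (norm (p - x)). (\<phi> has_real_derivative \<phi>1 r) (at r)"
    and \<phi>1: "(\<phi>1 has_real_derivative \<phi>2) (at (norm (p - x)))"
  shows "k \<le> (\<phi>1 (norm (p - x)))\<^sup>2 * \<phi>2"
proof (rule ccontr)
  define r where "r = norm (p - x)"
  assume "\<not> ?thesis"
  then have less: "(\<phi>1 r)\<^sup>2 * \<phi>2 < k" by (simp add: r_def)
  have r: "r > 0" using p by (simp add: r_def)
  define F where "F = (\<lambda>s. \<phi> (sqrt s))"
  define F1 where "F1 = (\<lambda>s. \<phi>1 (sqrt s) / (2 * sqrt s))"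
  define F2 where "F2 = \<phi>2 / (4 * r\<^sup>2) - \<phi>1 r / (4 * r^3)"
  \<comment> \<open>Raising the second derivative by \<open>\<eta>\<close> changes the infinity-Laplacian by \<open>16 F1\<^sup>2 r\<^sup>4 \<eta>\<close>,
    which has to stay below the gap \<open>k - \<phi>1\<^sup>2 \<phi>2\<close>.\<close>
  define \<eta> where "\<eta> = (k - (\<phi>1 r)\<^sup>2 * \<phi>2) / (16 * (F1 (r\<^sup>2))\<^sup>2 * r^4 + 1)"
  have den: "16 * (F1 (r\<^sup>2))\<^sup>2 * r^4 \<ge> 0" by simp
  have \<eta>: "\<eta> > 0" unfolding \<eta>_def using less den by (intro divide_pos_pos) linarith+
  have tl: "filterlim sqrt (nhds r) (nhds (r\<^sup>2))"
    using tendsto_real_sqrt[OF filterlim_ident, of "r\<^sup>2"] r by simp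
  have "\<forall>\<^sub>F s in nhds (r\<^sup>2). (\<phi> has_real_derivative \<phi>1 (sqrt s)) (at (sqrt s))"
    using filterlim_iff[THEN iffD1, OF tl] \<phi> by (auto simp: r_def)
  moreover have "\<forall>\<^sub>F s in nhds (r\<^sup>2). s > 0"
    using r eventually_nhds_in_open[of "{0<..}" "r\<^sup>2"] by simp
  ultimately have dF: "\<forall>\<^sub>F s in nhds (r\<^sup>2). (F has_real_derivative F1 s) (at s)"
  proof eventually_elim
    case (elim s)
    show ?case unfolding F_def F1_def
      using DERIV_chain2[OF elim(1) DERIV_real_sqrt[OF elim(2)]]
      by (simp add: field_simps)
  qed
  have "((\<lambda>s. \<phi>1 (sqrt s)) has_real_derivative \<phi>2 * (inverse (sqrt (r\<^sup>2)) / 2)) (at (r\<^sup>2))"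
    using r \<phi>1 by (intro DERIV_chain2[OF _ DERIV_real_sqrt]) (auto simp: r_def)
  then have dF1: "(F1 has_real_derivative F2) (at (r\<^sup>2))"
    unfolding F1_def F2_def using r
    by (auto intro!: derivative_eq_intros simp: field_simps power2_eq_square power3_eq_cube)
  have "\<forall>\<^sub>F s in nhds (r\<^sup>2). F s \<le> F (r\<^sup>2) + F1 (r\<^sup>2) * (s - r\<^sup>2) + (F2 + \<eta>) / 2 * (s - r\<^sup>2)\<^sup>2"
    by (rule second_order_upper_bound[OF dF dF1 \<eta>])
  moreover have "filterlim (\<lambda>y. (norm (y - x))\<^sup>2) (nhds (r\<^sup>2)) (at p)"
    unfolding r_def by (intro tendsto_intros)
  ultimately have "\<forall>\<^sub>F y in at p. F ((norm (y - x))\<^sup>2) \<le> F (r\<^sup>2) + F1 (r\<^sup>2) * ((norm (y - x))\<^sup>2 - r\<^sup>2)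
      + (F2 + \<eta>) / 2 * ((norm (y - x))\<^sup>2 - r\<^sup>2)\<^sup>2"
    by (auto simp: filterlim_iff)
  with touch have "\<forall>\<^sub>F y in at p. u y \<le> u p +
      radial_quartic x ((norm (p - x))\<^sup>2) (F1 (r\<^sup>2)) ((F2 + \<eta>) / 2) y"
    by eventually_elim (use r in \<open>simp add: F_def radial_quartic_def flip: r_def\<close>)
  then have "k \<le> 8 * (F1 (r\<^sup>2))^3 * r^2 + 32 * (F1 (r\<^sup>2))\<^sup>2 * ((F2 + \<eta>) / 2) * r^4"
    using u p unfolding radial_subsolution_def r_def by blast
  also have "\<dots> = (8 * (F1 (r\<^sup>2))^3 * r^2 + 16 * (F1 (r\<^sup>2))\<^sup>2 * F2 * r^4) + 16 * (F1 (r\<^sup>2))\<^sup>2 * r^4 * \<eta>"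
    by (simp add: algebra_simps)
  also have "8 * (F1 (r\<^sup>2))^3 * r^2 + 16 * (F1 (r\<^sup>2))\<^sup>2 * F2 * r^4 = (\<phi>1 r)\<^sup>2 * \<phi>2"
    using r by (simp add: F1_def F2_def field_simps power2_eq_square power3_eq_cube power4_eq_xxxx)
  also have "16 * (F1 (r\<^sup>2))\<^sup>2 * r^4 * \<eta> < k - (\<phi>1 r)\<^sup>2 * \<phi>2"
  proof -
    have "(16 * (F1 (r\<^sup>2))\<^sup>2 * r^4 + 1) * \<eta> = k - (\<phi>1 r)\<^sup>2 * \<phi>2"
      unfolding \<eta>_def using den by (intro nonzero_mult_div_cancel_left times_divide_eq_right[THEN trans]) linarith
    then show ?thesis using \<eta> by (simp add: distrib_right)
  qed
  finally show False by simp
qed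

text \<open>A subsolution lies below a strict radial supersolution that dominates it at the centre and on the
  sphere: otherwise the difference has a maximum in the punctured ball, where the profile may serve
  as a test function. The centre counts as a boundary point because a radial profile is in general
  not smooth there, and this is what makes it possible to prescribe its value.\<close>

lemma radial_comparison:
  fixes u :: "real^'n::finite \<Rightarrow> real"
  assumes u: "radial_subsolution S k u" and sub: "cball x R \<subseteq> S"
    and cont: "continuous_on {0..R} \<phi>"
    and \<phi>: "\<And>r. 0 < r \<Longrightarrow> r < R \<Longrightarrow> (\<phi> has_real_derivative \<phi>1 r) (at r)"
    and \<phi>1: "\<And>r. 0 < r \<Longrightarrow> r < R \<Longrightarrow> (\<phi>1 has_real_derivative \<phi>2 r) (at r)"
    and less: "\<And>r. 0 < r \<Longrightarrow> r < R \<Longrightarrow> (\<phi>1 r)\<^sup>2 * \<phi>2 r < k"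
    and centre: "u x \<le> \<phi> 0" and sphere: "\<And>y. norm (y - x) = R \<Longrightarrow> u y \<le> \<phi> R"
    and y: "0 < norm (y - x)" "norm (y - x) < R"
  shows "u y < \<phi> (norm (y - x))"
proof (rule ccontr)
  assume neg: "\<not> ?thesis"
  define h where "h = (\<lambda>y. u y - \<phi> (norm (y - x)))"
  have conth: "continuous_on (cball x R) h"
    unfolding h_def
    by (intro continuous_intros continuous_on_compose2[OF cont] continuous_on_subset[OF _ sub])
      (use u in \<open>auto simp: radial_subsolution_def dist_norm norm_minus_commute\<close>)
  have yR: "y \<in> cball x R" using y by (simp add: dist_norm norm_minus_commute)
  then obtain p where p: "p \<in> cball x R" "\<And>y. y \<in> cball x R \<Longrightarrow> h y \<le> h p"
    using continuous_attains_sup[OF compact_cball _ conth] by blast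
  have no_touch: False if q: "0 < norm (q - x)" "norm (q - x) < R"
    and max: "\<And>y. y \<in> cball x R \<Longrightarrow> h y \<le> h q" for q
  proof -
    have "\<forall>\<^sub>F y in at q. y \<in> ball x R"
      using q by (intro eventually_at_in_open') (auto simp: dist_norm norm_minus_commute)
    then have "\<forall>\<^sub>F y in at q. u y - \<phi> (norm (y - x)) \<le> u q - \<phi> (norm (q - x))"
      by eventually_elim (use max in \<open>auto simp: h_def\<close>)
    moreover have "\<forall>\<^sub>F r in nhds (norm (q - x)). r \<in> {0<..<R}"
      using q by (intro eventually_nhds_in_open) auto
    then have "\<forall>\<^sub>F r in nhds (norm (q - x)). (\<phi> has_real_derivative \<phi>1 r) (at r)"
      by eventually_elim (use \<phi> in auto)
    moreover have "q \<in> S" using q sub by (auto simp: dist_norm norm_minus_commute)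
    ultimately have "k \<le> (\<phi>1 (norm (q - x)))\<^sup>2 * \<phi>2 (norm (q - x))"
      using u q by (intro radial_subsolution_touch[OF u]) (auto intro: \<phi>1)
    with less[OF q] show False by simp
  qed
  show False
  proof (cases "0 < norm (p - x) \<and> norm (p - x) < R")
    case True
    with no_touch[of p] p(2) show False by auto
  next
    case False
    then have "p = x \<or> norm (p - x) = R"
      using p(1) by (auto simp: dist_norm norm_minus_commute)
    then have "h p \<le> 0"
      using centre sphere[of p] by (auto simp: h_def)
    moreover have "h y \<ge> 0" using neg by (simp add: h_def)
    ultimately show False
      using no_touch[OF y] p(2) yR by (meson order_trans)
  qed
qed


section \<open>Radial solutions of the equation with constant right-hand side\<close>

text \<open>The antiderivative of \<open>(C + 3 k r)\<^bsup>1/3\<^esup>\<close>, hence a solution of \<open>\<phi>'\<^sup>2 \<phi>'' = k\<close>. The case \<open>C = 0\<close> has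
  vanishing derivative at the centre and is a multiple of \<open>r\<^bsup>4/3\<^esup>\<close>.\<close>

definition radial_profile :: "real \<Rightarrow> real \<Rightarrow> real \<Rightarrow> real" where
  "radial_profile k C r = (C + 3 * k * r) powr (4/3) / (4 * k)"

lemma radial_profile_deriv:
  assumes "k > 0" "C \<ge> 0" "r > 0"
  shows "(radial_profile k C has_real_derivative (C + 3 * k * r) powr (1/3)) (at r)"
proof -
  have "C + 3 * k * r > 0" using assms by (simp add: add_nonneg_pos)
  then show ?thesis
    unfolding radial_profile_def using assms
    by (auto intro!: derivative_eq_intros simp: field_simps)
qed

lemma radial_profile_deriv2:
  assumes "k > 0" "C \<ge> 0" "r > 0"
  shows "((\<lambda>r. (C + 3 * k * r) powr (1/3)) has_real_derivative k * (C + 3 * k * r) powr (-2/3)) (at r)"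
proof -
  have "C + 3 * k * r > 0" using assms by (simp add: add_nonneg_pos)
  then show ?thesis
    using assms by (auto intro!: derivative_eq_intros simp: field_simps)
qed

lemma radial_profile_ode:
  fixes k C r :: real
  assumes "k > 0" "C \<ge> 0" "r > 0"
  shows "((C + 3 * k * r) powr (1/3))\<^sup>2 * (k * (C + 3 * k * r) powr (-2/3)) = k"
proof -
  have "C + 3 * k * r > 0" using assms by (simp add: add_nonneg_pos)
  then have "((C + 3 * k * r) powr (1/3))\<^sup>2 * (C + 3 * k * r) powr (-2/3) = 1"
    by (simp add: powr_powr powr_minus flip: powr_numeral)
  then show ?thesis by (metis mult.assoc mult.commute mult.right_neutral)
qed

lemma continuous_on_radial_profile [continuous_intros]:
  assumes "continuous_on S a" "continuous_on S b" "\<And>t. t \<in> S \<Longrightarrow> a t + 3 * k * b t \<ge> 0"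
  shows "continuous_on S (\<lambda>t. radial_profile k (a t) (b t))"
  unfolding radial_profile_def divide_inverse using assms
  by (intro continuous_intros continuous_on_powr') auto

lemma radial_profile_less:
  assumes "k > 0" "C \<ge> 0" "0 \<le> r" "r < s"
  shows "radial_profile k C r < radial_profile k C s"
  unfolding radial_profile_def using assms
  by (intro divide_strict_right_mono powr_less_mono2) auto

text \<open>The increment over \<open>[0, e]\<close> depends continuously on \<open>C\<close> and is unbounded, since it is at least
  \<open>e C\<^bsup>1/3\<^esup>\<close> by the mean value theorem; it thus takes every value above the increment for \<open>C = 0\<close>.\<close>

lemma radial_profile_increment:
  assumes k: "k > 0" and e: "e > 0" and A: "radial_profile k 0 e \<le> A"
  obtains C where "C \<ge> 0" "radial_profile k C e - radial_profile k C 0 = A"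
proof -
  define I where "I = (\<lambda>C. radial_profile k C e - radial_profile k C 0)"
  \<comment> \<open>Chosen so that the slope \<open>C1\<^bsup>1/3\<^esup>\<close> at the centre already produces the increment \<open>A\<close>.\<close>
  define C1 where "C1 = (max A 0 / e) powr 3"
  have C1: "C1 \<ge> 0" by (simp add: C1_def)
  have "continuous_on {0..e} (radial_profile k C1)"
    using k C1 by (intro continuous_intros) auto
  moreover have "radial_profile k C1 differentiable at r" if "0 < r" for r
    using radial_profile_deriv[OF k C1 that] unfolding real_differentiable_def by blast
  ultimately obtain l \<xi> where \<xi>0: "0 < \<xi>" "\<xi> < e" "(radial_profile k C1 has_real_derivative l) (at \<xi>)"
      "I C1 = (e - 0) * l"
    using MVT[OF e, of "radial_profile k C1"] unfolding I_def by blast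
  have "l = (C1 + 3 * k * \<xi>) powr (1/3)"
    by (rule DERIV_unique[OF \<xi>0(3) radial_profile_deriv[OF k C1 \<xi>0(1)]])
  then have \<xi>: "0 < \<xi>" "\<xi> < e" "I C1 = e * (C1 + 3 * k * \<xi>) powr (1/3)"
    using \<xi>0 by auto
  have "max A 0 / e = C1 powr (1/3)"
    using e unfolding C1_def powr_powr by simp
  also have "\<dots> \<le> (C1 + 3 * k * \<xi>) powr (1/3)"
    using k C1 \<xi> by (intro powr_mono2) auto
  finally have "A \<le> I C1"
    using e unfolding \<xi>(3) by (simp add: field_simps)
  moreover have "I 0 \<le> A"
    using A by (simp add: I_def radial_profile_def)
  moreover have "continuous_on {0..C1} I"
    unfolding I_def using k e by (intro continuous_intros) auto
  ultimately obtain C where "0 \<le> C" "I C = A"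
    using IVT'[of I 0 A C1] C1 by auto
  then show ?thesis using that by (simp add: I_def)
qed

section \<open>Minimal growth of subsolutions\<close>

text \<open>A function with a modulus of continuity of order above one has derivative zero and is locally
  constant; but then constants touch it from above, which is impossible when \<open>k > 0\<close>.\<close>

lemma subsolution_not_flat:
  fixes u :: "real^'n::finite \<Rightarrow> real"
  assumes u: "radial_subsolution S k u" and "k > 0" "x \<in> S" "r > 0" "1 < \<alpha>"
    and flat: "\<And>y z. y \<in> ball x r \<Longrightarrow> z \<in> ball x r \<Longrightarrow> u y \<le> u z + c * norm (y - z) powr \<alpha>"
  shows False
proof -
  have "(u has_derivative (\<lambda>h. 0)) (at y within ball x r)" if y: "y \<in> ball x r" for y
    unfolding has_derivative_iff_norm
  proof (intro conjI)
    have "((\<lambda>z. norm (z - y)) \<longlongrightarrow> norm (y - y)) (at y within ball x r)"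
      by (intro tendsto_intros)
    then have "((\<lambda>z. norm (z - y) powr (\<alpha> - 1)) \<longlongrightarrow> norm (y - y) powr (\<alpha> - 1)) (at y within ball x r)"
      using \<open>1 < \<alpha>\<close> by (intro tendsto_powr'[OF _ tendsto_const]) simp_all
    then have lim: "((\<lambda>z. \<bar>c\<bar> * norm (z - y) powr (\<alpha> - 1)) \<longlongrightarrow> 0) (at y within ball x r)"
      using tendsto_mult_right_zero by force
    have "\<forall>\<^sub>F z in at y within ball x r. norm (norm (u z - u y - 0) / norm (z - y)) \<le> \<bar>c\<bar> * norm (z - y) powr (\<alpha> - 1)"
      unfolding eventually_at_filter
    proof (intro always_eventually allI impI)
      fix z assume z: "z \<noteq> y" "z \<in> ball x r"
      have "c * norm (z - y) powr \<alpha> \<le> \<bar>c\<bar> * norm (z - y) powr \<alpha>"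
        by (intro mult_right_mono) auto
      then have "\<bar>u z - u y\<bar> \<le> \<bar>c\<bar> * norm (z - y) powr \<alpha>"
        using flat[OF y z(2)] flat[OF z(2) y] by (simp add: norm_minus_commute abs_le_iff)
      also have "\<dots> = \<bar>c\<bar> * norm (z - y) powr (\<alpha> - 1) * norm (z - y)"
        using z(1) by (simp add: powr_diff)
      finally show "norm (norm (u z - u y - 0) / norm (z - y)) \<le> \<bar>c\<bar> * norm (z - y) powr (\<alpha> - 1)"
        using z(1) by (simp add: pos_divide_le_eq)
    qed
    then show "((\<lambda>z. norm (u z - u y - 0) / norm (z - y)) \<longlongrightarrow> 0) (at y within ball x r)"
      using lim by (rule Lim_null_comparison)
  qed simp
  then obtain c where c: "\<And>y. y \<in> ball x r \<Longrightarrow> u y = c"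
    using has_derivative_zero_constant[OF convex_ball, of x r u] by blast
  have "\<forall>\<^sub>F y in at x. y \<in> ball x r"
    using \<open>r > 0\<close> by (intro eventually_at_in_open') auto
  then have "\<forall>\<^sub>F y in at x. u y \<le> u x + radial_quartic 0 ((norm (x - 0))\<^sup>2) 0 0 y"
    by eventually_elim (use c \<open>r > 0\<close> in \<open>simp add: radial_quartic_def\<close>)
  then have "k \<le> 8 * 0^3 * (norm (x - 0))^2 + 32 * 0\<^sup>2 * 0 * (norm (x - 0))^4"
    using u \<open>x \<in> S\<close> unfolding radial_subsolution_def by blast
  then show False using \<open>k > 0\<close> by simp
qed

text \<open>A subsolution with positive right-hand side grows at least like the profile with \<open>C = 0\<close>. Comparison
  on the ball about \<open>x\<close> alone does not show this, since the comparison principle says nothing about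
  a maximum of the difference at the centre. If the growth fails at \<open>x\<close>, however, then by continuity
  it fails at all nearby centres \<open>z\<close>, and comparison on all their balls yields
  \<open>u y \<le> u z + c \<bar>y - z\<bar>\<^bsup>4/3\<^esup>\<close> for all \<open>y\<close> and \<open>z\<close> near \<open>x\<close>. By the preceding lemma this cannot happen.\<close>

lemma subsolution_growth:
  fixes u :: "real^'n::finite \<Rightarrow> real"
  assumes u: "radial_subsolution S k' u" and k: "0 < k" "k < k'"
    and e: "0 < e" "e < R" and sub: "cball x R \<subseteq> S"
    and m: "\<And>y. y \<in> cball x e \<Longrightarrow> u y \<le> m"
  shows "u x + radial_profile k 0 e \<le> m"
proof (rule ccontr)
  assume neg: "\<not> ?thesis"
  define gap where "gap = u x + radial_profile k 0 e - m"
  define \<eta> where "\<eta> = gap / 2"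
  have \<eta>: "\<eta> > 0" using neg by (simp add: gap_def \<eta>_def)
  have "uniformly_continuous_on (cball x R) u"
    using u sub unfolding radial_subsolution_def
    by (intro compact_uniformly_continuous compact_cball) (metis continuous_on_subset)
  then obtain \<delta>0 where \<delta>0: "\<delta>0 > 0"
    "\<And>y z. y \<in> cball x R \<Longrightarrow> z \<in> cball x R \<Longrightarrow> dist z y < \<delta>0 \<Longrightarrow> dist (u z) (u y) < \<eta>"
    using \<eta> unfolding uniformly_continuous_on_def by meson
  define \<delta> where "\<delta> = min (e / 2) (min \<delta>0 (R - e))"
  have \<delta>: "\<delta> > 0" "\<delta> \<le> e / 2" "\<delta> \<le> \<delta>0" "\<delta> \<le> R - e"
    using e \<delta>0(1) unfolding \<delta>_def by (auto simp only: min_less_iff_conj min.cobounded1 min.coboundedI1 min.coboundedI2 order_refl half_gt_zero diff_gt_0_iff_gt)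
  have flat: "u y \<le> u z + 1 / (4 * k) * (3 * k) powr (4/3) * norm (y - z) powr (4/3)"
    if y: "y \<in> ball x \<delta>" and z: "z \<in> ball x \<delta>" for y z
  proof (cases "y = z")
    case False
    have yz: "norm (y - z) < e"
      using norm_triangle_ineq4[of "y - x" "z - x"] y z \<delta>(2)
      by (simp add: dist_norm norm_minus_commute)
    have sphere: "u q \<le> u z + radial_profile k 0 e" if q: "norm (q - z) = e" for q
    proof -
      have 1: "q - z + x \<in> cball x e" using q by (simp add: dist_norm norm_minus_commute)
      have 2: "dist (q - z + x) q < \<delta>0" "dist x z < \<delta>0" using z \<delta> by (auto simp: dist_norm norm_minus_commute)
      have 3: "norm (q - x) \<le> norm (q - z) + norm (z - x)"
        using norm_triangle_ineq[of "q - z" "z - x"] by simp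
      then have "q \<in> cball x R" "q - z + x \<in> cball x R" "z \<in> cball x R" "x \<in> cball x R"
        using 1 q z \<delta> e by (auto simp: dist_norm norm_minus_commute)
      then have "dist (u (q - z + x)) (u q) < \<eta>" "dist (u x) (u z) < \<eta>"
        using \<delta>0(2) 2 by auto
      then have "u q < u (q - z + x) + \<eta>" "u x < u z + \<eta>"
        unfolding dist_real_def by linarith+
      moreover have "u x + radial_profile k 0 e = m + gap" "gap = 2 * \<eta>"
        by (simp_all add: \<eta>_def gap_def)
      ultimately show ?thesis
        using m[OF 1] by linarith
    qed
    have "cball z e \<subseteq> cball x R"
      using z \<delta> by (intro cball_subset_cball_iff[THEN iffD2]) (auto simp: dist_commute)
    then have "u y < u z + radial_profile k 0 (norm (y - z))"
    proof (intro radial_comparison[OF u])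
      show "cball z e \<subseteq> S" using \<open>cball z e \<subseteq> cball x R\<close> sub by blast
      show "continuous_on {0..e} (\<lambda>r. u z + radial_profile k 0 r)"
        using k by (intro continuous_intros) auto
      fix r assume r: "0 < r" "r < e"
      show "((\<lambda>r. u z + radial_profile k 0 r) has_real_derivative (0 + 3 * k * r) powr (1/3)) (at r)"
        using DERIV_add[OF DERIV_const radial_profile_deriv[OF k(1) order_refl r(1)]] by simp
      show "((\<lambda>r. (0 + 3 * k * r) powr (1/3)) has_real_derivative k * (0 + 3 * k * r) powr (-2/3)) (at r)"
        by (rule radial_profile_deriv2[OF k(1) order_refl r(1)])
      show "((0 + 3 * k * r) powr (1/3))\<^sup>2 * (k * (0 + 3 * k * r) powr (-2/3)) < k'"
        unfolding radial_profile_ode[OF k(1) order_refl r(1)] by (rule k(2))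
    qed (use False yz sphere in \<open>auto simp: radial_profile_def[of k 0 0]\<close>)
    then show ?thesis
      using k by (simp add: radial_profile_def powr_mult field_simps)
  qed simp
  then show False
    using subsolution_not_flat[OF u _ _ \<delta>(1) _ flat, of x] k e subsetD[OF sub, of x] by simp
qed

section \<open>Doubling of variables\<close>

text \<open>Two comparisons exclude each other: the growth of \<open>u\<close> between the radii \<open>e\<close> and \<open>2 e\<close>, forced by its
  growth up to \<open>e\<close>, bounds \<open>w\<close> at the centre, and this bounds \<open>w z\<close> strictly below its actual value.
  The second profile is the first one run backwards, which changes the sign of the right-hand side.\<close>

lemma no_interior_doubling_maximum:
  fixes u w :: "real^'n::finite \<Rightarrow> real"
  assumes u: "radial_subsolution S k1 u" and w: "radial_subsolution S (- k2) w"
    and k: "0 < k" "k2 < k" "k < k1"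
    and e: "0 < e" and sub: "cball x (2 * e) \<subseteq> S"
    and y: "y \<in> cball x e" and z: "z \<in> cball x e"
    and max: "\<And>y' z'. y' \<in> cball x (2 * e) \<Longrightarrow> z' \<in> cball x (2 * e) \<Longrightarrow> dist y' z' \<le> 2 * e
               \<Longrightarrow> u y' + w z' \<le> u y + w z"
  shows False
proof -
  define T where "T = u y + w z"
  have "u y' \<le> u y" if "y' \<in> cball x e" for y'
  proof -
    have "dist y' z \<le> 2 * e"
      using that z dist_triangle[of y' z x] by (auto simp: dist_commute)
    then show ?thesis
      using max[of y' z] that z e by auto
  qed
  then have "u x + radial_profile k 0 e \<le> u y"
    using k e sub by (intro subsolution_growth[OF u, of k e "2 * e"]) auto
  then obtain C where C: "C \<ge> 0" "radial_profile k C e - radial_profile k C 0 = u y - u x"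
    using radial_profile_increment[of k e "u y - u x"] k e by auto
  define \<phi> where "\<phi> = (\<lambda>r. u x - radial_profile k C 0 + radial_profile k C r)"
  define \<phi>1 where "\<phi>1 = (\<lambda>r. (C + 3 * k * r) powr (1/3))"
  define \<phi>2 where "\<phi>2 = (\<lambda>r. k * (C + 3 * k * r) powr (-2/3))"
  have \<phi>0: "\<phi> 0 = u x" and \<phi>e: "\<phi> e = u y" using C by (auto simp: \<phi>_def)
  have mono: "\<phi> r \<le> \<phi> s" if "0 \<le> r" "r \<le> s" for r s
    using radial_profile_less[OF k(1) C(1) that(1), of s] that by (cases "r = s") (auto simp: \<phi>_def)
  have cont: "continuous_on {0..2 * e} \<phi>"
    unfolding \<phi>_def using k C by (intro continuous_intros) auto
  have d1: "(\<phi> has_real_derivative \<phi>1 r) (at r)" if "0 < r" for r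
    unfolding \<phi>_def \<phi>1_def using radial_profile_deriv[OF k(1) C(1) that]
    by (auto intro!: derivative_eq_intros)
  have d2: "(\<phi>1 has_real_derivative \<phi>2 r) (at r)" if "0 < r" for r
    unfolding \<phi>1_def \<phi>2_def using radial_profile_deriv2[OF k(1) C(1) that] .
  have ode: "(\<phi>1 r)\<^sup>2 * \<phi>2 r = k" if "0 < r" for r
    unfolding \<phi>1_def \<phi>2_def using radial_profile_ode[OF k(1) C(1) that] .
  have "y \<noteq> x"
    using radial_profile_less[OF k(1) C(1), of 0 e] e C(2) by auto
  \<comment> \<open>If \<open>u\<close> stayed below the profile on the outer sphere, it would lie strictly below it at \<open>y\<close>,
    where the profile is at most \<open>\<phi> e = u y\<close>.\<close>
  have "\<exists>q. norm (q - x) = 2 * e \<and> \<phi> (2 * e) < u q"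
  proof (rule ccontr)
    assume "\<not> ?thesis"
    then have "u y < \<phi> (norm (y - x))"
      using \<open>y \<noteq> x\<close> y e \<phi>0 k ode
      by (intro radial_comparison[OF u sub cont d1 d2])
        (auto simp: dist_norm norm_minus_commute not_less)
    also have "\<dots> \<le> \<phi> e"
      using y by (intro mono) (auto simp: dist_norm norm_minus_commute)
    finally show False using \<phi>e by simp
  qed
  then obtain q where q: "norm (q - x) = 2 * e" "\<phi> (2 * e) < u q" by blast
  have "u q + w x \<le> T"
    unfolding T_def using q e by (intro max) (auto simp: dist_norm norm_minus_commute)
  then have wx: "w x < T - \<phi> (2 * e)" using q by simp
  have sphere: "w p \<le> T - \<phi> 0" if "norm (p - x) = 2 * e" for p
    using max[of x p] that e \<phi>0 by (auto simp: T_def dist_norm norm_minus_commute)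
  \<comment> \<open>Comparison of \<open>w\<close> with the reversed profile.\<close>
  have "w z < T - \<phi> (2 * e - norm (z - x))"
  proof (cases "z = x")
    case False
    have cont': "continuous_on {0..2 * e} (\<lambda>r. T - \<phi> (2 * e - r))"
      by (intro continuous_intros continuous_on_compose2[OF cont]) auto
    show ?thesis
    proof (rule radial_comparison[OF w sub cont', of "\<lambda>r. \<phi>1 (2 * e - r)" "\<lambda>r. - \<phi>2 (2 * e - r)"])
      fix r assume r: "0 < r" "r < 2 * e"
      have rev: "((\<lambda>r. 2 * e - r) has_real_derivative -1) (at r)"
        by (auto intro!: derivative_eq_intros)
      show "((\<lambda>r. T - \<phi> (2 * e - r)) has_real_derivative \<phi>1 (2 * e - r)) (at r)"
        using DERIV_diff[OF DERIV_const DERIV_chain2[OF d1 rev]] r by simp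
      show "((\<lambda>r. \<phi>1 (2 * e - r)) has_real_derivative - \<phi>2 (2 * e - r)) (at r)"
        using DERIV_chain2[OF d2 rev] r by simp
      show "(\<phi>1 (2 * e - r))\<^sup>2 * - \<phi>2 (2 * e - r) < - k2"
        using ode[of "2 * e - r"] r k by simp
    qed (use wx sphere False z e in \<open>auto simp: dist_norm norm_minus_commute\<close>)
  qed (use wx in simp)
  also have "\<dots> \<le> T - \<phi> e"
    using z e by (auto intro!: mono simp: dist_norm norm_minus_commute)
  finally show False
    using \<phi>e by (simp add: T_def)
qed

lemma SUP_eq_at_interior_maximum:
  fixes h :: "'a::metric_space \<Rightarrow> real"
  assumes "x \<in> \<Omega>" "\<And>y. y \<in> \<Omega> \<Longrightarrow> h y \<le> h x"
  shows "h x = (SUP y\<in>\<Omega>. h y)"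
  using assms by (intro cSup_eq_maximum[symmetric]) auto

text \<open>Maximising pairs of \<open>u y + w z\<close> under the constraint \<open>\<bar>y - z\<bar> \<le> 2 e\<close> accumulate, as \<open>e\<close> tends to
  zero, at a diagonal point. It maximises \<open>u + w\<close>, because the diagonal pairs compete for every \<open>e\<close>.\<close>

lemma doubling_maximum_points:
  fixes u w :: "'a::euclidean_space \<Rightarrow> real"
  assumes K: "compact K" "K \<noteq> {}" and "continuous_on K u" "continuous_on K w"
  obtains x0 where "x0 \<in> K" "\<And>x. x \<in> K \<Longrightarrow> u x + w x \<le> u x0 + w x0"
    "\<And>\<rho>. 0 < \<rho> \<Longrightarrow> \<exists>e y z. 0 < e \<and> e < \<rho> \<and> y \<in> K \<inter> ball x0 \<rho> \<and> z \<in> K \<inter> ball x0 \<rho> \<and> dist y z \<le> 2 * e \<and>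
        (\<forall>y'\<in>K. \<forall>z'\<in>K. dist y' z' \<le> 2 * e \<longrightarrow> u y' + w z' \<le> u y + w z)"
proof -
  let ?h = "\<lambda>p. u (fst p) + w (snd p)"
  define e where "e = (\<lambda>n. inverse (real (Suc n)))"
  have e: "e n > 0" for n by (simp add: e_def)
  have e0: "e \<longlonglongrightarrow> 0" unfolding e_def by (rule LIMSEQ_inverse_real_of_nat)
  have conth: "continuous_on (K \<times> K) ?h"
    by (rule continuous_on_add continuous_on_compose2[OF assms(3)] continuous_on_compose2[OF assms(4)]
        continuous_on_fst continuous_on_snd continuous_on_id | force)+
  have "\<exists>p\<in>K \<times> K \<inter> {p. dist (fst p) (snd p) \<le> 2 * e n}. \<forall>q\<in>K \<times> K \<inter> {p. dist (fst p) (snd p) \<le> 2 * e n}. ?h q \<le> ?h p" for n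
  proof (rule continuous_attains_sup)
    show "compact (K \<times> K \<inter> {p. dist (fst p) (snd p) \<le> 2 * e n})"
      using K by (intro compact_Int_closed compact_Times closed_Collect_le continuous_intros)
    obtain a where "a \<in> K" using K by blast
    then have "(a, a) \<in> K \<times> K \<inter> {p. dist (fst p) (snd p) \<le> 2 * e n}"
      using e[of n] by auto
    then show "K \<times> K \<inter> {p. dist (fst p) (snd p) \<le> 2 * e n} \<noteq> {}" by blast
    show "continuous_on (K \<times> K \<inter> {p. dist (fst p) (snd p) \<le> 2 * e n}) ?h"
      using conth by (rule continuous_on_subset) auto
  qed
  then have "\<forall>n. \<exists>p. p \<in> K \<times> K \<and> dist (fst p) (snd p) \<le> 2 * e n \<and>
      (\<forall>q\<in>K \<times> K. dist (fst q) (snd q) \<le> 2 * e n \<longrightarrow> ?h q \<le> ?h p)"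
    by blast
  then obtain P where P: "\<And>n. P n \<in> K \<times> K" "\<And>n. dist (fst (P n)) (snd (P n)) \<le> 2 * e n"
      and Pmax: "\<And>n q. q \<in> K \<times> K \<Longrightarrow> dist (fst q) (snd q) \<le> 2 * e n \<Longrightarrow> ?h q \<le> ?h (P n)"
    unfolding choice_iff by blast
  obtain l s where l: "l \<in> K \<times> K" and s: "strict_mono s" and lim: "(P \<circ> s) \<longlonglongrightarrow> l"
    using compact_Times[OF K(1) K(1), unfolded compact_def, rule_format, of P] P(1) by blast
  have es: "(\<lambda>n. e (s n)) \<longlonglongrightarrow> 0"
    using LIMSEQ_subseq_LIMSEQ[OF e0 s] by (simp add: o_def)
  have lim1: "(\<lambda>n. fst (P (s n))) \<longlonglongrightarrow> fst l" and lim2: "(\<lambda>n. snd (P (s n))) \<longlonglongrightarrow> snd l"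
    using lim by (auto simp: o_def intro: tendsto_fst tendsto_snd)
  have "dist (fst l) (snd l) \<le> 2 * 0"
    by (rule tendsto_le[OF _ tendsto_mult[OF tendsto_const es] tendsto_dist[OF lim1 lim2]])
      (use P(2) in auto)
  then have l12: "snd l = fst l" by simp
  have limh: "(\<lambda>n. ?h (P (s n))) \<longlonglongrightarrow> ?h l"
    using continuous_on_tendsto_compose[OF conth lim l] P(1) by (simp add: o_def)
  show thesis
  proof (rule that[of "fst l"])
    show "fst l \<in> K" using l by auto
    show "u x + w x \<le> u (fst l) + w (fst l)" if "x \<in> K" for x
    proof -
      have "?h (x, x) \<le> ?h l"
        using that by (intro LIMSEQ_le_const[OF limh] exI allI impI Pmax) (auto intro: less_imp_le e)
      then show ?thesis by (simp add: l12)
    qed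
    fix \<rho> :: real assume "0 < \<rho>"
    then have "\<forall>\<^sub>F n in sequentially. e (s n) < \<rho>"
      "\<forall>\<^sub>F n in sequentially. dist (fst (P (s n))) (fst l) < \<rho>"
      "\<forall>\<^sub>F n in sequentially. dist (snd (P (s n))) (fst l) < \<rho>"
      using order_tendstoD(2)[OF es] tendstoD[OF lim1] tendstoD[OF lim2] by (auto simp: l12)
    then have "\<forall>\<^sub>F n in sequentially. e (s n) < \<rho> \<and> dist (fst (P (s n))) (fst l) < \<rho> \<and> dist (snd (P (s n))) (fst l) < \<rho>"
      by eventually_elim auto
    then obtain n where n: "e (s n) < \<rho>" "dist (fst (P (s n))) (fst l) < \<rho>" "dist (snd (P (s n))) (fst l) < \<rho>"
      using eventually_happens'[OF sequentially_bot] by blast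
    show "\<exists>e y z. 0 < e \<and> e < \<rho> \<and> y \<in> K \<inter> ball (fst l) \<rho> \<and> z \<in> K \<inter> ball (fst l) \<rho> \<and> dist y z \<le> 2 * e \<and>
        (\<forall>y'\<in>K. \<forall>z'\<in>K. dist y' z' \<le> 2 * e \<longrightarrow> u y' + w z' \<le> u y + w z)"
    proof (intro exI conjI ballI impI)
      show "0 < e (s n)" "e (s n) < \<rho>" "dist (fst (P (s n))) (snd (P (s n))) \<le> 2 * e (s n)"
        by (fact e n(1) P(2))+
      show "fst (P (s n)) \<in> K \<inter> ball (fst l) \<rho>" "snd (P (s n)) \<in> K \<inter> ball (fst l) \<rho>"
        using n P(1)[of "s n"] by (auto simp: dist_commute mem_Times_iff)
      show "u y' + w z' \<le> u (fst (P (s n))) + w (snd (P (s n)))"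
        if "y' \<in> K" "z' \<in> K" "dist y' z' \<le> 2 * e (s n)" for y' z'
        using Pmax[of "(y', z')" "s n"] that by simp
    qed
  qed
qed

section \<open>Comparison of the source terms at an extremal point\<close>

text \<open>The point is the accumulation point of the maximising pairs. If \<open>f < g\<close> held there, continuity would
  give constants that separate \<open>- g\<close> from \<open>- f\<close> on a whole ball containing a maximising pair and all
  competitors within distance \<open>2 e\<close> of its midpoint, contrary to \<open>no_interior_doubling_maximum\<close>.\<close>

lemma maximum_with_source_inequality:
  fixes u v :: "real^'n::finite \<Rightarrow> real"
  assumes \<Omega>: "open \<Omega>" "\<Omega> \<noteq> {}" "bounded \<Omega>"
    and f: "continuous_on (\<Omega> \<times> UNIV) (\<lambda>(x, s). f x s)"
    and g: "continuous_on (\<Omega> \<times> UNIV) (\<lambda>(x, s). g x s)"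
    and u: "continuous_on (closure \<Omega>) u" and v: "continuous_on (closure \<Omega>) v"
    and sup: "(SUP x\<in>\<Omega>. u x - v x) > (SUP x\<in>frontier \<Omega>. u x - v x)"
    and vu: "viscosity_ge \<Omega> (\<lambda>x s. - f x s) u" and vv: "viscosity_le \<Omega> (\<lambda>x s. - g x s) v"
  shows "\<exists>p\<in>\<Omega>. u p - v p = (SUP x\<in>\<Omega>. u x - v x) \<and> g p (v p) \<le> f p (u p)"
proof -
  let ?K = "closure \<Omega>" and ?w = "\<lambda>x. - v x"
  have K: "compact ?K" "?K \<noteq> {}" using \<Omega> by (auto simp: compact_closure)
  have w: "continuous_on ?K ?w" using v by (intro continuous_intros)
  obtain x0 where x0: "x0 \<in> ?K" "\<And>x. x \<in> ?K \<Longrightarrow> u x + ?w x \<le> u x0 + ?w x0"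
    and pts: "\<And>\<rho>. 0 < \<rho> \<Longrightarrow> \<exists>e y z. 0 < e \<and> e < \<rho> \<and> y \<in> ?K \<inter> ball x0 \<rho> \<and> z \<in> ?K \<inter> ball x0 \<rho> \<and> dist y z \<le> 2 * e \<and>
        (\<forall>y'\<in>?K. \<forall>z'\<in>?K. dist y' z' \<le> 2 * e \<longrightarrow> u y' + ?w z' \<le> u y + ?w z)"
    using doubling_maximum_points[OF K u w] by metis
  have max: "u x - v x \<le> u x0 - v x0" if "x \<in> ?K" for x using x0(2)[OF that] by simp
  have "x0 \<in> \<Omega>"
  proof (rule ccontr)
    assume "x0 \<notin> \<Omega>"
    then have fr: "x0 \<in> frontier \<Omega>" using x0(1) \<Omega>(1) by (simp add: frontier_def interior_open)
    have "frontier \<Omega> \<subseteq> ?K" by (auto simp: frontier_def)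
    then have "u x0 - v x0 \<le> (SUP x\<in>frontier \<Omega>. u x - v x)"
      using fr max by (intro cSUP_upper bdd_aboveI2[where M = "u x0 - v x0"]) auto
    moreover have "(SUP x\<in>\<Omega>. u x - v x) \<le> u x0 - v x0"
      using \<Omega>(2) max closure_subset by (intro cSUP_least) auto
    ultimately show False using sup by linarith
  qed
  have "u x0 - v x0 = (SUP x\<in>\<Omega>. u x - v x)"
    using \<open>x0 \<in> \<Omega>\<close> max closure_subset by (intro SUP_eq_at_interior_maximum) auto
  moreover have "g x0 (v x0) \<le> f x0 (u x0)"
  proof (rule ccontr)
    assume neg: "\<not> ?thesis"
    have u\<Omega>: "continuous_on \<Omega> u" and v\<Omega>: "continuous_on \<Omega> v"
      using u v closure_subset by (auto intro: continuous_on_subset)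
    have "continuous_on \<Omega> (\<lambda>x. case (x, u x) of (x, s) \<Rightarrow> f x s)"
      by (rule continuous_on_compose2[OF f]) (auto intro!: continuous_intros u\<Omega>)
    then have cf: "continuous_on \<Omega> (\<lambda>x. f x (u x))" by simp
    have "continuous_on \<Omega> (\<lambda>x. case (x, v x) of (x, s) \<Rightarrow> g x s)"
      by (rule continuous_on_compose2[OF g]) (auto intro!: continuous_intros v\<Omega>)
    then have cg: "continuous_on \<Omega> (\<lambda>x. g x (v x))" by simp
    \<comment> \<open>The right-hand side must not vanish: its sign decides which of the two functions is forced
      to grow.\<close>
    obtain k where k: "k \<noteq> 0" "- g x0 (v x0) < k" "k < - f x0 (u x0)"
    proof -
      obtain a where a: "- g x0 (v x0) < a" "a < - f x0 (u x0)"
        using dense[of "- g x0 (v x0)" "- f x0 (u x0)"] neg unfolding neg_less_iff_less not_le by blast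
      obtain b where "a < b" "b < - f x0 (u x0)" using dense[OF a(2)] by blast
      then show thesis using that[of a] that[of b] a by (cases "a = 0") auto
    qed
    obtain k1 where k1: "k < k1" "k1 < - f x0 (u x0)" using dense[OF k(3)] by blast
    obtain k2 where k2: "- g x0 (v x0) < k2" "k2 < k" using dense[OF k(2)] by blast
    define S where "S = (\<Omega> \<inter> (\<lambda>x. f x (u x)) -` {..<- k1}) \<inter> (\<Omega> \<inter> (\<lambda>x. g x (v x)) -` {- k2<..})"
    have "open S"
      unfolding S_def using cf cg \<Omega>(1)
      by (intro open_Int[OF continuous_open_preimage continuous_open_preimage]) auto
    have "x0 \<in> S" using \<open>x0 \<in> \<Omega>\<close> k1 k2 by (auto simp: S_def)
    then obtain r where r: "r > 0" "ball x0 r \<subseteq> S"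
      using \<open>open S\<close> open_contains_ball by blast
    obtain e y z where e: "0 < e" "e < r / 4" and yz: "y \<in> ball x0 (r / 4)" "z \<in> ball x0 (r / 4)" "dist y z \<le> 2 * e"
      and emax: "\<And>y' z'. y' \<in> ?K \<Longrightarrow> z' \<in> ?K \<Longrightarrow> dist y' z' \<le> 2 * e \<Longrightarrow> u y' + ?w z' \<le> u y + ?w z"
      using pts[of "r / 4"] r(1) unfolding zero_less_divide_iff Int_iff by force
    define x where "x = midpoint y z"
    have xyz: "y \<in> cball x e" "z \<in> cball x e"
      using yz(3) by (auto simp: x_def dist_midpoint)
    have "dist x0 x \<le> dist x0 y + dist y x" by (rule dist_triangle)
    then have "cball x (2 * e) \<subseteq> ball x0 r"
      using yz(1) xyz(1) e by (intro cball_subset_ball_iff[THEN iffD2]) (auto simp: dist_commute)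
    then have sub: "cball x (2 * e) \<subseteq> S" using r by blast
    have "S \<subseteq> \<Omega>" by (auto simp: S_def)
    have emax': "u y' + ?w z' \<le> u y + ?w z"
      if "y' \<in> cball x (2 * e)" "z' \<in> cball x (2 * e)" "dist y' z' \<le> 2 * e" for y' z'
    proof (rule emax)
      have "cball x (2 * e) \<subseteq> ?K"
        using sub \<open>S \<subseteq> \<Omega>\<close> closure_subset[of \<Omega>] by (rule subset_trans[OF subset_trans])
      with that show "y' \<in> ?K" "z' \<in> ?K" "dist y' z' \<le> 2 * e" by auto
    qed
    have su: "radial_subsolution S k1 u"
      using vu \<open>S \<subseteq> \<Omega>\<close> by (rule viscosity_ge_imp_radial_subsolution) (auto simp: S_def)
    have sw: "radial_subsolution S (- k2) ?w"
      using vv \<open>S \<subseteq> \<Omega>\<close> by (rule viscosity_le_imp_radial_subsolution) (auto simp: S_def)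
    show False
    proof (cases "k > 0")
      case True
      show False
        using no_interior_doubling_maximum[OF su sw True k2(2) k1(1) e(1) sub xyz] emax' by blast
    next
      case False
      have su': "radial_subsolution S (- (- k1)) u" using su by simp
      have "0 < - k" "- k1 < - k" "- k < - k2" using False k(1) k1 k2 by auto
      moreover have "?w z' + u y' \<le> ?w z + u y"
        if "z' \<in> cball x (2 * e)" "y' \<in> cball x (2 * e)" "dist z' y' \<le> 2 * e" for y' z'
        using emax'[OF that(2,1)] that(3) by (simp add: dist_commute)
      ultimately show False
        using no_interior_doubling_maximum[OF sw su' _ _ _ e(1) sub xyz(2,1), of "- k"] by blast
    qed
  qed
  ultimately show ?thesis using \<open>x0 \<in> \<Omega>\<close> by blast
qed

lemma INF_eq_uminus_SUP:
  fixes a b :: "'a \<Rightarrow> real"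
  shows "(INF x\<in>A. a x - b x) = - (SUP x\<in>A. b x - a x)"
  unfolding Inf_real_def image_image by simp

theorem lemma2p1:
  fixes \<Omega> :: "(real^'n::finite) set"
    and f g :: "real^'n \<Rightarrow> real \<Rightarrow> real"
    and u v :: "real^'n \<Rightarrow> real"
  assumes "CARD('n) \<ge> 2"
    and "open \<Omega>" "connected \<Omega>" "\<Omega> \<noteq> {}" "bounded \<Omega>"
    and "continuous_on (\<Omega> \<times> UNIV) (\<lambda>(x, s). f x s)"
    and "continuous_on (\<Omega> \<times> UNIV) (\<lambda>(x, s). g x s)"
    and "continuous_on (closure \<Omega>) u"
    and "continuous_on (closure \<Omega>) v"
  shows "((SUP x\<in>\<Omega>. u x - v x) > (SUP x\<in>frontier \<Omega>. u x - v x) \<longrightarrow>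
          viscosity_ge \<Omega> (\<lambda>x s. - f x s) u \<longrightarrow>
          viscosity_le \<Omega> (\<lambda>x s. - g x s) v \<longrightarrow>
          (\<exists>p\<in>\<Omega>. u p - v p = (SUP x\<in>\<Omega>. u x - v x) \<and> g p (v p) \<le> f p (u p))) \<and>
         ((INF x\<in>\<Omega>. u x - v x) < (INF x\<in>frontier \<Omega>. u x - v x) \<longrightarrow>
          viscosity_le \<Omega> (\<lambda>x s. - f x s) u \<longrightarrow>
          viscosity_ge \<Omega> (\<lambda>x s. - g x s) v \<longrightarrow>
          (\<exists>q\<in>\<Omega>. u q - v q = (INF x\<in>\<Omega>. u x - v x) \<and> f q (u q) \<le> g q (v q)))"
proof (intro conjI impI)
  assume "(SUP x\<in>\<Omega>. u x - v x) > (SUP x\<in>frontier \<Omega>. u x - v x)"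
    "viscosity_ge \<Omega> (\<lambda>x s. - f x s) u" "viscosity_le \<Omega> (\<lambda>x s. - g x s) v"
  with assms(2,4-9) show "\<exists>p\<in>\<Omega>. u p - v p = (SUP x\<in>\<Omega>. u x - v x) \<and> g p (v p) \<le> f p (u p)"
    by (rule maximum_with_source_inequality)
next
  assume "(INF x\<in>\<Omega>. u x - v x) < (INF x\<in>frontier \<Omega>. u x - v x)"
    and visc: "viscosity_le \<Omega> (\<lambda>x s. - f x s) u" "viscosity_ge \<Omega> (\<lambda>x s. - g x s) v"
  then have "(SUP x\<in>\<Omega>. v x - u x) > (SUP x\<in>frontier \<Omega>. v x - u x)"
    unfolding INF_eq_uminus_SUP by linarith
  from maximum_with_source_inequality[OF assms(2,4,5,7,6,9,8) this] visc
  obtain q where q: "q \<in> \<Omega>" "v q - u q = (SUP x\<in>\<Omega>. v x - u x)" "f q (u q) \<le> g q (v q)"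
    by blast
  then have "u q - v q = (INF x\<in>\<Omega>. u x - v x)"
    unfolding INF_eq_uminus_SUP by linarith
  with q show "\<exists>q\<in>\<Omega>. u q - v q = (INF x\<in>\<Omega>. u x - v x) \<and> f q (u q) \<le> g q (v q)"
    by blast
qed

end
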